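(* Let $c,k$ be positive integers with $k$ odd, let $d,l,z$ be nonnegative integers, let $\zeta_{2c}$ be a primitive $2c$-th root of unity, and let $P\in\mathbb{Z}[\zeta_{2c}][x]$. If $n$ is an integer with $n\ge(\deg(P)+2(l+d)+1)kc$, then $$\sum_{m=0}^n \zeta_{2c}^m P(m)\,(q^z)^m\,\frac{d^l}{dq^l}\left[\binom{n}{m}_q\right]\equiv 0 \pmod{\Phi_{kc}(q)^{d+1}},$$ i.e. $\Phi_{kc}(q)^{d+1}$ divides the left-hand side in $\mathbb{Z}[\zeta_{2c}][q]$.
   Context: For integers $0\le m\le n$, the $q$-binomial coefficient is the polynomial $\binom{n}{m}_q=\frac{(1-q^n)(1-q^{n-1})\cdots(1-q^{n-m+1})}{(1-q^m)(1-q^{m-1})\cdots(1-q)}\in\mathbb{Z}[q]$. $\Phi_N(q)$ denotes the $N$-th cyclotomic polynomial. $\frac{d^l}{dq^l}$ is the $l$-th formal derivative with respect to $q$. *)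

theory Defs
  imports Complex_Main "HOL-Computational_Algebra.Polynomial"
begin

definition qbinom_num :: "nat \<Rightarrow> nat \<Rightarrow> int poly" where
  "qbinom_num n m = (\<Prod>i<m. 1 - monom 1 (n - i))"

definition qbinom_den :: "nat \<Rightarrow> int poly" where
  "qbinom_den m = (\<Prod>i=1..m. 1 - monom 1 i)"

text \<open>For \<open>m \<le> n\<close> the division below is exact, see \<open>qbinom_times_den\<close>.\<close>

definition qbinom :: "nat \<Rightarrow> nat \<Rightarrow> int poly" where
  "qbinom n m = qbinom_num n m div qbinom_den m"

definition primitive_root_of_unity :: "nat \<Rightarrow> complex \<Rightarrow> bool" where
  "primitive_root_of_unity N w \<longleftrightarrow> N > 0 \<and> w ^ N = 1 \<and> (\<forall>j. 0 < j \<and> j < N \<longrightarrow> w ^ j \<noteq> 1)"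

definition cyclotomic_poly :: "nat \<Rightarrow> complex poly" where
  "cyclotomic_poly N = (\<Prod>w\<in>{w. primitive_root_of_unity N w}. [:- w, 1:])"

definition int_adjoin :: "complex \<Rightarrow> complex set" where
  "int_adjoin w = range (\<lambda>p :: int poly. poly (map_poly of_int p) w)"

definition polys_over :: "complex set \<Rightarrow> complex poly set" where
  "polys_over R = {p. \<forall>i. coeff p i \<in> R}"

definition dvd_over :: "complex set \<Rightarrow> complex poly \<Rightarrow> complex poly \<Rightarrow> bool" where
  "dvd_over R f g \<longleftrightarrow> (\<exists>h\<in>polys_over R. g = f * h)"

lemma qbinom_den_nonzero: "qbinom_den m \<noteq> 0"
proof -
  have "1 - monom (1::int) i \<noteq> 0" if "i \<ge> 1" for i
  proof
    assume "1 - monom (1::int) i = 0"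
    then have "coeff (1 - monom (1::int) i) 0 = 0" by simp
    then show False using that by simp
  qed
  then show ?thesis by (auto simp: qbinom_den_def)
qed

lemma qbinom_num_eq_0:
  assumes "n < m"
  shows "qbinom_num n m = 0"
  unfolding qbinom_num_def
  by (rule prod_zero) (use assms in \<open>auto intro!: bexI[of _ n] simp: monom_0\<close>)

lemma qbinom_den_dvd_num: "qbinom_den m dvd qbinom_num n m"
proof (induction n arbitrary: m)
  case 0
  show ?case
    by (cases m) (auto simp: qbinom_num_eq_0, simp add: qbinom_den_def qbinom_num_def)
next
  case (Suc n m)
  show ?case
  proof (cases "m = 0 \<or> m > Suc n")
    case True
    then show ?thesis
      by (auto simp: qbinom_num_eq_0) (simp add: qbinom_den_def qbinom_num_def)
  next
    case False
    then obtain j where m: "m = Suc j" and j: "j \<le> n"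
      by (cases m) auto
    have den: "qbinom_den m = qbinom_den j * (1 - monom 1 m)"
      by (simp add: qbinom_den_def m)
    have num1: "qbinom_num (Suc n) m = (1 - monom 1 (Suc n)) * qbinom_num n j"
      by (simp add: qbinom_num_def m prod.lessThan_Suc_shift del: prod.lessThan_Suc)
    have num2: "qbinom_num n m = qbinom_num n j * (1 - monom 1 (n - j))"
      by (simp add: qbinom_num_def m)
    have "monom (1::int) (n - j) * monom 1 m = monom 1 (Suc n)"
      using j by (simp add: mult_monom m)
    then have "qbinom_num (Suc n) m
        = qbinom_num n m + monom 1 (n - j) * (qbinom_num n j * (1 - monom 1 m))"
      unfolding num1 num2 by (simp add: algebra_simps flip: mult.assoc)
    moreover have "qbinom_den m dvd qbinom_num n j * (1 - monom 1 m)"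
      unfolding den by (intro mult_dvd_mono Suc.IH) simp
    ultimately show ?thesis
      using Suc.IH[of m] by (simp add: dvd_add)
  qed
qed

lemma qbinom_times_den: "qbinom n m * qbinom_den m = qbinom_num n m"
  unfolding qbinom_def using qbinom_den_dvd_num by (rule dvd_div_mult_self)

end

theory Submission
  imports Defs
begin

text \<open>
  Let \<open>N = k c\<close>, \<open>\<phi>\<close> the \<open>N\<close>-th cyclotomic polynomial in \<open>q\<close>, and \<open>A = 1 + x^N\<close>. Filter the ring
  of polynomials in \<open>x\<close> and \<open>q\<close> by giving \<open>\<phi>\<close> weight 2 and \<open>A\<close> weight 1. The Rogers-Szego
  polynomial, the sum of \<open>[n, m]_q x^m\<close> over \<open>m\<close>, equals \<open>(X + T)^n 1\<close>, where \<open>X\<close> multiplies by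
  \<open>x\<close> and \<open>T\<close> substitutes \<open>q x\<close> for \<open>x\<close>. Since \<open>\<phi>\<close> divides \<open>[N, m]_q\<close> for \<open>0 < m < N\<close>, the
  operator \<open>(X + T)^N\<close> is congruent to \<open>X^N + T^N\<close>, and it raises weights by at least 1. Hence the
  Rogers-Szego polynomial has weight at least \<open>n div N\<close>. Each derivative in \<open>q\<close> costs weight 2,
  each Euler operator \<open>x d/dx\<close> costs weight 1, and \<open>x = \<zeta> q^z\<close> maps \<open>A\<close> to \<open>1 - q^(z N)\<close>, a
  multiple of \<open>\<phi>\<close>; so the remaining weight \<open>2 d + 1\<close> yields the factor \<open>\<phi>^(d + 1)\<close>. The quotient
  has coefficients in the subring because \<open>\<phi>\<close> is monic with integer coefficients.
\<close>

section \<open>Cyclotomic polynomials\<close>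

lemma finite_primitive_roots: "finite {w. primitive_root_of_unity N w}"
proof (cases "N = 0")
  case False
  have "finite {w::complex. w ^ N = 1}"
    using False by (intro finite_roots_unity) auto
  then show ?thesis
    by (rule rev_finite_subset) (auto simp: primitive_root_of_unity_def)
qed (simp add: primitive_root_of_unity_def)

lemma primitive_root_pow_eq_1_iff:
  assumes "primitive_root_of_unity N w"
  shows "w ^ i = 1 \<longleftrightarrow> N dvd i"
proof
  have N: "N > 0" "w ^ N = 1" using assms by (auto simp: primitive_root_of_unity_def)
  assume "w ^ i = 1"
  have "w ^ i = w ^ (i mod N)"
    using N by (metis mod_mult_div_eq power_add power_mult power_one mult.right_neutral)
  with \<open>w ^ i = 1\<close> have "w ^ (i mod N) = 1" by simp
  then show "N dvd i"
    using assms N(1) unfolding primitive_root_of_unity_def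
    by (metis mod_less_divisor mod_0_imp_dvd neq0_conv)
next
  assume "N dvd i"
  then show "w ^ i = 1"
    using assms by (auto simp: primitive_root_of_unity_def power_mult elim!: dvdE)
qed

lemma prod_linear_dvd:
  fixes p :: "'a::field poly"
  assumes "finite S" "\<And>w. w \<in> S \<Longrightarrow> poly p w = 0"
  shows "(\<Prod>w\<in>S. [:- w, 1:]) dvd p"
  using assms
proof (induction S arbitrary: p rule: finite_induct)
  case (insert a S)
  then obtain r where r: "p = [:- a, 1:] * r"
    by (meson insertI1 poly_eq_0_iff_dvd dvdE)
  have "poly r w = 0" if "w \<in> S" for w
  proof -
    have "poly p w = 0" "w \<noteq> a" using insert that by auto
    then show ?thesis by (simp add: r del: mult_pCons_left)
  qed
  then have "(\<Prod>w\<in>S. [:- w, 1:]) dvd r" by (rule insert.IH)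
  then show ?case
    unfolding prod.insert[OF insert.hyps] r by (rule mult_dvd_mono[OF dvd_refl])
qed simp

lemma cyclotomic_poly_dvd:
  assumes "\<And>w. primitive_root_of_unity N w \<Longrightarrow> poly p w = 0"
  shows "cyclotomic_poly N dvd p"
  unfolding cyclotomic_poly_def
  by (rule prod_linear_dvd) (use assms finite_primitive_roots in auto)

lemma degree_prod_linear:
  "degree (\<Prod>w\<in>S. [:- w, 1::'a::field:]) = card S"
  by (subst degree_prod_eq_sum_degree) auto

lemma monic_prod_linear:
  "lead_coeff (\<Prod>w\<in>S. [:- w, 1::'a::field:]) = 1"
  by (simp add: lead_coeff_prod)

lemma monic_cyclotomic_poly: "lead_coeff (cyclotomic_poly N) = 1"
  unfolding cyclotomic_poly_def by (rule monic_prod_linear)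

text \<open>Both sides are monic of degree \<open>N\<close>, and the left divides the right because
  its linear factors are distinct, so the quotient is 1.\<close>

lemma prod_roots_of_unity:
  assumes "N > 0"
  shows "(\<Prod>w\<in>{w::complex. w ^ N = 1}. [:- w, 1:]) = monom 1 N - 1" (is "?L = ?R")
proof -
  have fin: "finite {w::complex. w ^ N = 1}"
    using assms by (intro finite_roots_unity) auto
  have deg: "degree ?L = N"
    unfolding degree_prod_linear using card_roots_unity_eq[of N] assms by simp
  have "?L dvd ?R"
    by (rule prod_linear_dvd[OF fin]) (auto simp: poly_monom)
  then obtain r where r: "?R = ?L * r" by (elim dvdE)
  have cR: "coeff ?R N = 1" using assms by simp
  then have R0: "?R \<noteq> 0" by (metis coeff_0 zero_neq_one)
  have dR: "degree ?R \<le> N" by (intro degree_diff_le) (auto simp: degree_monom_le)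
  have "r \<noteq> 0" "?L \<noteq> 0" using R0 r by auto
  then have "degree ?R = N + degree r"
    using deg by (subst r) (simp add: degree_mult_eq)
  with dR have dr: "degree r = 0" and "degree ?R = N" by auto
  then have "lead_coeff ?R = 1" using cR by simp
  then have "lead_coeff r = 1"
    unfolding r lead_coeff_mult monic_prod_linear by simp
  with dr have "r = 1" by (auto elim!: degree_eq_zeroE)
  with r show ?thesis by simp
qed

text \<open>Each \<open>N\<close>-th root of unity is primitive for exactly one divisor of
  \<open>N\<close>, its order; the product over all of them is grouped by that order.\<close>

lemma monom_minus_1_eq_prod_cyclotomic:
  assumes "N > 0"
  shows "monom 1 N - 1 = (\<Prod>d | d dvd N. cyclotomic_poly d)"
proof -
  define ord where "ord w = (LEAST j. 0 < j \<and> w ^ j = 1)" for w :: complex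
  have prim_iff: "primitive_root_of_unity j w \<longleftrightarrow> ord w = j" if "w ^ N = 1" for w j
  proof
    assume "primitive_root_of_unity j w"
    then show "ord w = j"
      unfolding ord_def primitive_root_of_unity_def
      by (intro Least_equality) (auto simp: not_less[symmetric])
  next
    assume j: "ord w = j"
    have "0 < ord w \<and> w ^ ord w = 1"
      unfolding ord_def by (rule LeastI[of _ N]) (use assms that in auto)
    moreover have "w ^ i \<noteq> 1" if "0 < i" "i < ord w" for i
      using not_less_Least[of i "\<lambda>j. 0 < j \<and> w ^ j = 1"] that unfolding ord_def by auto
    ultimately show "primitive_root_of_unity j w"
      by (auto simp: primitive_root_of_unity_def j)
  qed
  have sub: "ord ` {w. w ^ N = 1} \<subseteq> {d. d dvd N}"
    using prim_iff primitive_root_pow_eq_1_iff by fastforce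
  have eq: "{w. w ^ N = 1 \<and> ord w = d} = {w. primitive_root_of_unity d w}" if "d dvd N" for d
  proof -
    have "w ^ N = 1" if "primitive_root_of_unity d w" for w
      using primitive_root_pow_eq_1_iff[OF that] \<open>d dvd N\<close> by simp
    then show ?thesis using prim_iff by blast
  qed
  have "monom 1 N - 1 = (\<Prod>w\<in>{w::complex. w ^ N = 1}. [:- w, 1:])"
    using prod_roots_of_unity[OF assms] by simp
  also have "\<dots> = (\<Prod>d | d dvd N. \<Prod>w\<in>{w. w \<in> {w. w ^ N = 1} \<and> ord w = d}. [:- w, 1:])"
    using assms sub by (intro prod.group[symmetric] finite_roots_unity) auto
  also have "\<dots> = (\<Prod>d | d dvd N. cyclotomic_poly d)"
    by (intro prod.cong refl) (simp add: cyclotomic_poly_def eq)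
  finally show ?thesis .
qed

section \<open>Polynomials over a subring\<close>

definition is_subring :: "complex set \<Rightarrow> bool" where
  "is_subring R \<longleftrightarrow> \<int> \<subseteq> R \<and> (\<forall>x\<in>R. \<forall>y\<in>R. x + y \<in> R \<and> x * y \<in> R)"

lemma is_subringD:
  assumes "is_subring R"
  shows "0 \<in> R" "1 \<in> R" "of_int i \<in> R" "of_nat j \<in> R"
    and "x \<in> R \<Longrightarrow> y \<in> R \<Longrightarrow> x + y \<in> R"
    and "x \<in> R \<Longrightarrow> y \<in> R \<Longrightarrow> x * y \<in> R"
  using assms unfolding is_subring_def by (auto dest: subsetD[OF _ Ints_of_nat])

lemma is_subring_uminus:
  assumes "is_subring R" "x \<in> R" shows "- x \<in> R"
  using is_subringD(6)[OF assms(1) is_subringD(3)[OF assms(1), of "-1"] assms(2)] by simp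

lemma is_subring_diff:
  assumes "is_subring R" "x \<in> R" "y \<in> R" shows "x - y \<in> R"
  using is_subringD(5)[OF assms(1,2) is_subring_uminus[OF assms(1,3)]] by simp

lemma is_subring_sum:
  assumes "is_subring R" "\<And>i. i \<in> I \<Longrightarrow> f i \<in> R"
  shows "sum f I \<in> R"
  using assms(2) by (induction I rule: infinite_finite_induct) (auto simp: is_subringD[OF assms(1)])

lemma is_subring_power:
  assumes "is_subring R" "x \<in> R"
  shows "x ^ n \<in> R"
  by (induction n) (auto simp: is_subringD[OF assms(1)] assms(2))

lemma is_subring_Ints: "is_subring \<int>"
  by (auto simp: is_subring_def)

lemma map_poly_of_int_add:
  "map_poly of_int (p + r) = map_poly of_int p + (map_poly of_int r :: 'a::comm_ring_1 poly)"
  by (intro poly_eqI) (simp add: coeff_map_poly)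

lemma map_poly_of_int_mult:
  "map_poly of_int (p * r) = map_poly of_int p * (map_poly of_int r :: 'a::comm_ring_1 poly)"
  by (intro poly_eqI) (simp add: coeff_map_poly coeff_mult)

lemma is_subring_int_adjoin: "is_subring (int_adjoin w)"
proof -
  have "of_int i \<in> int_adjoin w" for i
    unfolding int_adjoin_def by (rule range_eqI[of _ _ "[:i:]"]) (simp add: map_poly_pCons)
  moreover have "x + y \<in> int_adjoin w \<and> x * y \<in> int_adjoin w"
    if xy: "x \<in> int_adjoin w" "y \<in> int_adjoin w" for x y
  proof -
    obtain p r where *: "x = poly (map_poly of_int p) w" "y = poly (map_poly of_int r) w"
      using xy unfolding int_adjoin_def by auto
    have "x + y = poly (map_poly of_int (p + r)) w"
      unfolding * by (simp add: map_poly_of_int_add)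
    moreover have "x * y = poly (map_poly of_int (p * r)) w"
      unfolding * by (simp add: map_poly_of_int_mult)
    ultimately show ?thesis unfolding int_adjoin_def by blast
  qed
  ultimately show ?thesis unfolding is_subring_def by (auto elim!: Ints_cases)
qed

lemma self_in_int_adjoin: "w \<in> int_adjoin w"
  unfolding int_adjoin_def by (rule range_eqI[of _ _ "[:0, 1:]"]) (simp add: map_poly_pCons)

lemma polys_over_monom: "is_subring R \<Longrightarrow> a \<in> R \<Longrightarrow> monom a i \<in> polys_over R"
  by (simp add: polys_over_def is_subringD)

lemma polys_over_1: "is_subring R \<Longrightarrow> 1 \<in> polys_over R"
  using polys_over_monom[of R 1 0] by (simp add: is_subringD monom_0 one_pCons)

lemma polys_over_diff:
  "is_subring R \<Longrightarrow> p \<in> polys_over R \<Longrightarrow> r \<in> polys_over R \<Longrightarrow> p - r \<in> polys_over R"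
  by (simp add: polys_over_def is_subring_diff)

lemma polys_over_mult:
  "is_subring R \<Longrightarrow> p \<in> polys_over R \<Longrightarrow> r \<in> polys_over R \<Longrightarrow> p * r \<in> polys_over R"
  by (auto simp: polys_over_def coeff_mult intro!: is_subring_sum is_subringD(6))

lemma polys_over_smult:
  "is_subring R \<Longrightarrow> a \<in> R \<Longrightarrow> p \<in> polys_over R \<Longrightarrow> smult a p \<in> polys_over R"
  by (simp add: polys_over_def is_subringD)

lemma polys_over_sum:
  "is_subring R \<Longrightarrow> (\<And>i. i \<in> I \<Longrightarrow> f i \<in> polys_over R) \<Longrightarrow> sum f I \<in> polys_over R"
  by (auto simp: polys_over_def coeff_sum intro!: is_subring_sum)

lemma polys_over_prod:
  assumes "is_subring R" "\<And>i. i \<in> I \<Longrightarrow> f i \<in> polys_over R"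
  shows "prod f I \<in> polys_over R"
  using assms(2)
  by (induction I rule: infinite_finite_induct) (auto simp: polys_over_1 polys_over_mult assms(1))

lemma polys_over_power:
  assumes "is_subring R" "p \<in> polys_over R"
  shows "p ^ j \<in> polys_over R"
  by (induction j) (auto simp: polys_over_1 polys_over_mult assms)

lemma polys_over_map_poly_of_int: "is_subring R \<Longrightarrow> map_poly of_int p \<in> polys_over R"
  by (simp add: polys_over_def coeff_map_poly is_subringD)

lemma poly_in_subring:
  "is_subring R \<Longrightarrow> p \<in> polys_over R \<Longrightarrow> x \<in> R \<Longrightarrow> poly p x \<in> R"
  by (auto simp: polys_over_def poly_altdef intro!: is_subring_sum is_subringD(6) is_subring_power)

text \<open>The coefficients of \<open>h\<close> are recovered from the top down: as
  \<open>f\<close> is monic, the coefficient of \<open>f * h\<close> at \<open>degree f + i\<close>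
  is \<open>coeff h i\<close> plus products that vanish or involve higher coefficients of
  \<open>h\<close>.\<close>

lemma polys_over_monic_quotient:
  assumes R: "is_subring R" and f: "f \<in> polys_over R" "lead_coeff f = 1"
    and fh: "f * h \<in> polys_over R"
  shows "h \<in> polys_over R"
proof -
  have "coeff h i \<in> R" for i
  \<comment> \<open>The \<open>Suc\<close> makes the measure drop also from
    \<open>i = degree h\<close> to larger indices.\<close>
  proof (induction "Suc (degree h) - i" arbitrary: i rule: less_induct)
    case less
    show ?case
    proof (cases "i > degree h")
      case True
      then show ?thesis by (simp add: coeff_eq_0 is_subringD[OF R])
    next
      case False
      let ?n = "degree f"
      let ?s = "\<Sum>j\<in>{..?n + i} - {?n}. coeff f j * coeff h (?n + i - j)"
      have "coeff (f * h) (?n + i) = coeff h i + ?s"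
        unfolding coeff_mult by (subst sum.remove[of _ ?n]) (use f in auto)
      moreover have "coeff (f * h) (?n + i) \<in> R" using fh by (simp add: polys_over_def)
      moreover have "?s \<in> R"
      proof (rule is_subring_sum[OF R])
        fix j assume j: "j \<in> {..?n + i} - {?n}"
        show "coeff f j * coeff h (?n + i - j) \<in> R"
        proof (cases "j > ?n")
          case True
          then show ?thesis by (simp add: coeff_eq_0 is_subringD[OF R])
        next
          case False
          then have "coeff h (?n + i - j) \<in> R"
            using j \<open>\<not> i > degree h\<close> by (intro less) auto
          then show ?thesis using f by (simp add: polys_over_def is_subringD[OF R])
        qed
      qed
      ultimately show ?thesis using is_subring_diff[OF R] by (metis add_diff_cancel_right')
    qed
  qed
  then show ?thesis by (simp add: polys_over_def)
qed

text \<open>Strong induction: for \<open>N > 0\<close> this is the quotient of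
  \<open>monom 1 N - 1\<close> by the product over the proper divisors, which is monic and
  integral.\<close>

lemma cyclotomic_poly_over_Ints: "cyclotomic_poly N \<in> polys_over \<int>"
proof (induction N rule: less_induct)
  case (less N)
  show ?case
  proof (cases "N = 0")
    case True
    then show ?thesis
      by (simp add: cyclotomic_poly_def primitive_root_of_unity_def polys_over_1[OF is_subring_Ints])
  next
    case False
    let ?f = "\<Prod>d\<in>{d. d dvd N} - {N}. cyclotomic_poly d"
    have "monom 1 N - 1 = cyclotomic_poly N * ?f"
      using False by (subst monom_minus_1_eq_prod_cyclotomic) (auto intro!: prod.remove)
    moreover have "monom 1 N - 1 \<in> polys_over \<int>"
      by (intro polys_over_diff polys_over_monom polys_over_1 is_subring_Ints) auto
    moreover have "?f \<in> polys_over \<int>"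
    proof (rule polys_over_prod[OF is_subring_Ints])
      fix d assume "d \<in> {d. d dvd N} - {N}"
      then have "d < N" using False by (auto dest: dvd_imp_le)
      then show "cyclotomic_poly d \<in> polys_over \<int>" by (rule less)
    qed
    moreover have "lead_coeff ?f = 1"
      by (simp add: lead_coeff_prod monic_cyclotomic_poly)
    ultimately show ?thesis
      using polys_over_monic_quotient[OF is_subring_Ints] by (metis mult.commute)
  qed
qed

lemma cyclotomic_poly_over: "is_subring R \<Longrightarrow> cyclotomic_poly N \<in> polys_over R"
  using cyclotomic_poly_over_Ints[of N] by (auto simp: polys_over_def is_subring_def)

section \<open>Gaussian binomial coefficients\<close>

definition qbin :: "nat \<Rightarrow> nat \<Rightarrow> complex poly" where
  "qbin n m = map_poly of_int (qbinom n m)"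

lemma qbinom_0 [simp]: "qbinom n 0 = 1"
  using qbinom_times_den[of n 0] by (simp add: qbinom_den_def qbinom_num_def)

lemma qbinom_eq_0: "n < m \<Longrightarrow> qbinom n m = 0"
  using qbinom_times_den[of n m] by (simp add: qbinom_num_eq_0 qbinom_den_nonzero)

text \<open>The q-Pascal rule, checked after multiplication by the nonzero
  \<open>qbinom_den (Suc j)\<close>, which removes the division.\<close>

lemma qbinom_Suc_Suc:
  "qbinom (Suc n) (Suc j) = qbinom n j + monom 1 (Suc j) * qbinom n (Suc j)"
proof (cases "j \<le> n")
  case True
  have den: "qbinom_den (Suc j) = qbinom_den j * (1 - monom 1 (Suc j))"
    by (simp add: qbinom_den_def)
  have num1: "qbinom_num (Suc n) (Suc j) = (1 - monom 1 (Suc n)) * qbinom_num n j"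
    by (simp add: qbinom_num_def prod.lessThan_Suc_shift del: prod.lessThan_Suc)
  have num2: "qbinom_num n (Suc j) = qbinom_num n j * (1 - monom 1 (n - j))"
    by (simp add: qbinom_num_def)
  have mon: "monom (1::int) (Suc n) = monom 1 (Suc j) * monom 1 (n - j)"
    using True by (simp add: mult_monom)
  have "(qbinom n j + monom 1 (Suc j) * qbinom n (Suc j)) * qbinom_den (Suc j)
      = (qbinom n j * qbinom_den j) * (1 - monom 1 (Suc j))
        + monom 1 (Suc j) * (qbinom n (Suc j) * qbinom_den (Suc j))"
    unfolding den by (simp only: algebra_simps)
  also have "\<dots> = qbinom_num (Suc n) (Suc j)"
    unfolding qbinom_times_den num1 num2 mon by (simp only: algebra_simps)
  also have "\<dots> = qbinom (Suc n) (Suc j) * qbinom_den (Suc j)"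
    by (rule qbinom_times_den[symmetric])
  finally show ?thesis using qbinom_den_nonzero by simp
qed (simp add: qbinom_eq_0)

lemma qbin_0 [simp]: "qbin n 0 = 1"
  by (simp add: qbin_def)

lemma qbin_eq_0: "n < m \<Longrightarrow> qbin n m = 0"
  by (simp add: qbin_def qbinom_eq_0)

lemma qbin_Suc_Suc: "qbin (Suc n) (Suc j) = qbin n j + monom 1 (Suc j) * qbin n (Suc j)"
  by (simp add: qbin_def qbinom_Suc_Suc map_poly_of_int_add map_poly_of_int_mult map_poly_monom)

lemma qbin_self [simp]: "qbin n n = 1"
  by (induction n) (auto simp: qbin_Suc_Suc qbin_eq_0)

text \<open>At a primitive \<open>N\<close>-th root of unity the numerator vanishes through its
  factor \<open>1 - monom 1 N\<close>, while the denominator involves only exponents from 1 to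
  \<open>m < N\<close> and does not vanish.\<close>

lemma cyclotomic_poly_dvd_qbin:
  assumes "0 < m" "m < N"
  shows "cyclotomic_poly N dvd qbin N m"
proof (rule cyclotomic_poly_dvd)
  fix w assume w: "primitive_root_of_unity N w"
  have ev_prod: "poly (map_poly of_int (prod f I)) w = (\<Prod>i\<in>I. poly (map_poly of_int (f i)) w)"
    for f :: "nat \<Rightarrow> int poly" and I
    by (induction I rule: infinite_finite_induct) (auto simp: map_poly_of_int_mult)
  have ev: "poly (map_poly of_int (1 - monom 1 i)) w = 1 - w ^ i" for i
  proof -
    have "map_poly of_int (1 - monom 1 i) = (1 - monom 1 i :: complex poly)"
      by (intro poly_eqI) (simp add: coeff_map_poly)
    then show ?thesis by (simp add: poly_monom)
  qed
  have num: "poly (map_poly of_int (qbinom_num N m)) w = 0"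
    unfolding qbinom_num_def ev_prod ev
    using assms w by (auto intro!: prod_zero bexI[of _ 0] simp: primitive_root_of_unity_def)
  have den: "poly (map_poly of_int (qbinom_den m)) w \<noteq> 0"
    unfolding qbinom_den_def ev_prod ev
    using assms w by (auto simp: primitive_root_of_unity_def)
  have "poly (qbin N m) w * poly (map_poly of_int (qbinom_den m)) w = 0"
    unfolding qbin_def using num qbinom_times_den[of N m]
    by (metis map_poly_of_int_mult poly_mult)
  then show "poly (qbin N m) w = 0" using den by simp
qed

section \<open>The Rogers-Szego recurrence\<close>

text \<open>In \<open>complex poly poly\<close> the outer variable is \<open>x\<close> and the
  coefficients are polynomials in \<open>q\<close>; this is the substitution of \<open>u x\<close>
  for \<open>x\<close>.\<close>

abbreviation scale :: "complex poly \<Rightarrow> complex poly poly \<Rightarrow> complex poly poly" where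
  "scale u f \<equiv> pcompose f [:0, u:]"

lemma scale_1: "scale 1 f = f"
  by (intro poly_eqI) (simp add: coeff_pcompose_linear)

lemma scale_scale: "scale u (scale v f) = scale (u * v) f"
  by (intro poly_eqI) (simp add: coeff_pcompose_linear power_mult_distrib mult.assoc)

lemma scale_monom: "scale u (monom p m) = monom (u ^ m * p) m"
  by (intro poly_eqI) (simp add: coeff_pcompose_linear)

lemma scale_power: "scale u (f ^ a) = scale u f ^ a"
  by (induction a) (auto simp: pcompose_mult pcompose_1)

definition rs_step :: "complex poly poly \<Rightarrow> complex poly poly" where
  "rs_step f = monom 1 1 * f + scale (monom 1 1) f"

text \<open>Writing \<open>X\<close> for multiplication by \<open>x\<close> and \<open>T\<close> for \<open>x \<mapsto> q x\<close>, so that \<open>T X = q X T\<close>,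
  this is the noncommutative binomial theorem for \<open>(X + T)^n\<close>.\<close>

lemma rs_step_funpow:
  "(rs_step ^^ n) f = (\<Sum>m\<le>n. monom (qbin n m) m * scale (monom 1 (n - m)) f)"
proof (induction n)
  case 0
  show ?case by (simp add: monom_eq_1 scale_1)
next
  case (Suc n)
  let ?t = "\<lambda>m. scale (monom 1 (Suc n - m)) f"
  have 1: "monom 1 1 * (\<Sum>m\<le>n. monom (qbin n m) m * scale (monom 1 (n - m)) f)
      = (\<Sum>m\<le>n. monom (qbin n m) (Suc m) * ?t (Suc m))"
    unfolding sum_distrib_left by (intro sum.cong refl) (simp add: mult_monom flip: mult.assoc)
  have "scale (monom 1 1) (\<Sum>m\<le>n. monom (qbin n m) m * scale (monom 1 (n - m)) f)
      = (\<Sum>m\<le>n. monom (monom 1 m * qbin n m) m * ?t m)"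
    unfolding pcompose_sum
    by (intro sum.cong refl)
      (simp add: pcompose_mult scale_monom scale_scale mult_monom monom_power Suc_diff_le)
  \<comment> \<open>The added term is zero since \<open>qbin n (Suc n) = 0\<close>; after the index
    shift the sum lines up with the q-Pascal rule.\<close>
  also have "\<dots> = (\<Sum>m\<le>Suc n. monom (monom 1 m * qbin n m) m * ?t m)"
    by (simp add: qbin_eq_0)
  also have "\<dots> = monom 1 0 * ?t 0
      + (\<Sum>m\<le>n. monom (monom 1 (Suc m) * qbin n (Suc m)) (Suc m) * ?t (Suc m))"
    by (subst sum.atMost_Suc_shift) (simp add: monom_eq_1)
  finally have "(rs_step ^^ Suc n) f = monom 1 0 * ?t 0
      + (\<Sum>m\<le>n. monom (qbin (Suc n) (Suc m)) (Suc m) * ?t (Suc m))"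
    by (simp only: funpow.simps comp_apply Suc.IH rs_step_def 1 qbin_Suc_Suc
        add_monom[symmetric] distrib_right sum.distrib add_ac)
  also have "\<dots> = (\<Sum>m\<le>Suc n. monom (qbin (Suc n) m) m * ?t m)"
    by (subst sum.atMost_Suc_shift) simp
  finally show ?case .
qed

lemma coeff_rs_step_funpow_1: "coeff ((rs_step ^^ n) 1) m = qbin n m"
  by (simp add: rs_step_funpow pcompose_1 coeff_sum qbin_eq_0)

section \<open>The weighted filtration\<close>

text \<open>The ideal generated by all \<open>\<phi> ^ e * A ^ a\<close> of weight
  \<open>2 * e + a\<close> at least \<open>r\<close>. The free factor \<open>g\<close> absorbs
  multiplication, so closing under addition is enough, and later properties need checking only on
  one generator.\<close>

inductive_set filt :: "complex poly \<Rightarrow> complex poly poly \<Rightarrow> nat \<Rightarrow> complex poly poly set"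
  for \<phi> A r where
  filt_gen: "r \<le> 2 * e + a \<Longrightarrow> smult (\<phi> ^ e) (A ^ a * g) \<in> filt \<phi> A r"
| filt_add: "f \<in> filt \<phi> A r \<Longrightarrow> g \<in> filt \<phi> A r \<Longrightarrow> f + g \<in> filt \<phi> A r"

lemma filt_mono: "f \<in> filt \<phi> A s \<Longrightarrow> r \<le> s \<Longrightarrow> f \<in> filt \<phi> A r"
  by (induction rule: filt.induct) (auto intro: filt.intros)

lemma filt_0 [simp]: "f \<in> filt \<phi> A 0"
  using filt_gen[of 0 0 0 \<phi> A f] by simp

lemma zero_in_filt [simp]: "0 \<in> filt \<phi> A r"
  using filt_gen[of r r r \<phi> A 0] by simp

lemma filt_sum: "(\<And>i. i \<in> I \<Longrightarrow> f i \<in> filt \<phi> A r) \<Longrightarrow> sum f I \<in> filt \<phi> A r"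
  by (induction I rule: infinite_finite_induct) (auto intro: filt_add)

lemma filt_mult:
  assumes "f \<in> filt \<phi> A r" "g \<in> filt \<phi> A s"
  shows "f * g \<in> filt \<phi> A (r + s)"
  using assms(1)
proof (induction rule: filt.induct)
  case (filt_gen e a h)
  from assms(2) show ?case
  proof (induction rule: filt.induct)
    case (filt_gen e' a' h')
    have "smult (\<phi> ^ e) (A ^ a * h) * smult (\<phi> ^ e') (A ^ a' * h')
        = smult (\<phi> ^ (e + e')) (A ^ (a + a') * (h * h'))"
      by (simp add: power_add mult_ac)
    also have "\<dots> \<in> filt \<phi> A (r + s)"
      using filt_gen \<open>r \<le> 2 * e + a\<close> by (intro filt.filt_gen) auto
    finally show ?case .
  qed (auto simp: distrib_left intro: filt_add)
qed (auto simp: distrib_right intro: filt_add)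

lemma filt_mult_left: "g \<in> filt \<phi> A r \<Longrightarrow> f * g \<in> filt \<phi> A r"
  using filt_mult[of f \<phi> A 0 g r] by simp

lemma filt_power_self: "A ^ a \<in> filt \<phi> A a"
  using filt_gen[of a 0 a \<phi> A 1] by simp

lemma filt_smult_power: "f \<in> filt \<phi> A r \<Longrightarrow> smult (\<phi> ^ e) f \<in> filt \<phi> A (2 * e + r)"
  using filt_mult[OF filt_gen[of "2 * e" e 0 \<phi> A 1], of f r] by simp

lemma filt_2I:
  assumes "\<And>i. \<phi> dvd coeff f i"
  shows "f \<in> filt \<phi> A 2"
proof -
  have "[:\<phi>:] dvd f" using assms by (simp add: const_poly_dvd_iff)
  then obtain h where "f = smult \<phi> h" by (auto elim!: dvdE)
  then show ?thesis using filt_smult_power[of h \<phi> A 0 1] by simp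
qed

lemma filt_power:
  assumes "f \<in> filt \<phi> A 1" shows "f ^ a \<in> filt \<phi> A a"
proof (induction a)
  case (Suc a)
  then show ?case using filt_mult[OF assms Suc] by simp
qed simp

section \<open>Weights under the substitutions and under the Rogers-Szego operator\<close>

lemma scale_diff_filt_2:
  assumes "\<phi> dvd u - 1"
  shows "scale u g - g \<in> filt \<phi> A 2"
proof (rule filt_2I)
  fix i
  have "u - 1 dvd u ^ i - 1"
    by (simp add: power_diff_1_eq)
  then have "\<phi> dvd (u ^ i - 1) * coeff g i" using assms by (meson dvd_mult2 dvd_trans)
  then show "\<phi> dvd coeff (scale u g - g) i"
    by (simp add: coeff_pcompose_linear algebra_simps)
qed

text \<open>Scaling changes \<open>A\<close> only by \<open>(u^N - 1) x^N\<close>, a multiple of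
  \<open>\<phi>\<close> and so of weight 2; the image of \<open>A\<close> still has weight at least
  1.\<close>

lemma scale_in_filt:
  assumes "\<phi> dvd u ^ N - 1" and A: "A = 1 + monom 1 N" and "f \<in> filt \<phi> A r"
  shows "scale u f \<in> filt \<phi> A r"
  using assms(3)
proof (induction rule: filt.induct)
  case (filt_gen e a g)
  have "scale u A = A + monom (u ^ N - 1) N"
    unfolding A by (simp add: pcompose_add pcompose_1 scale_monom diff_monom[symmetric])
  moreover have "monom (u ^ N - 1) N \<in> filt \<phi> A 2"
    using assms(1) by (intro filt_2I) auto
  ultimately have "scale u A \<in> filt \<phi> A 1"
    using filt_power_self[of A 1 \<phi>] by (auto intro!: filt_add elim: filt_mono)
  then have "scale u g * scale u A ^ a \<in> filt \<phi> A a"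
    by (intro filt_mult_left filt_power)
  then have "smult (\<phi> ^ e) (scale u g * scale u A ^ a) \<in> filt \<phi> A (2 * e + a)"
    by (rule filt_smult_power)
  then show ?case
    using filt_gen by (simp add: pcompose_smult pcompose_mult scale_power mult.commute filt_mono)
qed (auto simp: pcompose_add intro: filt_add)

text \<open>With \<open>T = scale u\<close>, the rule
  \<open>T(f g) - f g = T f (T g - g) + (T f - f) g\<close> lets the difference act on one factor at
  a time. A factor \<open>A\<close> passes from weight 1 to 2 and a cofactor from 0 to 2, so every
  term gains at least one.\<close>

lemma scale_diff_in_filt:
  assumes u: "\<phi> dvd u - 1" and A: "A = 1 + monom 1 N" and "f \<in> filt \<phi> A r"
  shows "scale u f - f \<in> filt \<phi> A (r + 1)"
  using assms(3)
proof (induction rule: filt.induct)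
  case (filt_gen e a g)
  have uN: "\<phi> dvd u ^ N - 1"
    using u by (simp add: power_diff_1_eq dvd_mult2)
  have pow: "scale u (A ^ a) - A ^ a \<in> filt \<phi> A (a + 1)"
  proof (induction a)
    case (Suc a)
    have "scale u A \<in> filt \<phi> A 1"
      using scale_in_filt[OF uN A filt_power_self[of A 1]] by simp
    from filt_mult[OF this Suc]
    have 1: "scale u A * (scale u (A ^ a) - A ^ a) \<in> filt \<phi> A (Suc a + 1)" by simp
    have "(scale u A - A) * A ^ a \<in> filt \<phi> A (2 + a)"
      by (rule filt_mult[OF scale_diff_filt_2[OF u] filt_power_self])
    then have "scale u A * (scale u (A ^ a) - A ^ a) + (scale u A - A) * A ^ a
        \<in> filt \<phi> A (Suc a + 1)"
      using 1 by (intro filt_add) auto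
    then show ?case by (simp add: pcompose_mult algebra_simps)
  qed (simp add: pcompose_1)
  have "scale u g * (scale u (A ^ a) - A ^ a) + A ^ a * (scale u g - g) \<in> filt \<phi> A (a + 1)"
    using filt_mono[OF filt_mult[OF filt_power_self[of A a] scale_diff_filt_2[OF u, of g]], of "a + 1"]
    by (intro filt_add filt_mult_left[OF pow]) simp
  then have "smult (\<phi> ^ e) (scale u g * (scale u (A ^ a) - A ^ a) + A ^ a * (scale u g - g))
      \<in> filt \<phi> A (2 * e + (a + 1))"
    by (rule filt_smult_power)
  then have "smult (\<phi> ^ e) (scale u g * (scale u (A ^ a) - A ^ a) + A ^ a * (scale u g - g))
      \<in> filt \<phi> A (r + 1)"
    using filt_gen by (elim filt_mono) auto
  also have "smult (\<phi> ^ e) (scale u g * (scale u (A ^ a) - A ^ a) + A ^ a * (scale u g - g))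
      = scale u (smult (\<phi> ^ e) (A ^ a * g)) - smult (\<phi> ^ e) (A ^ a * g)"
    by (simp add: pcompose_smult pcompose_mult algebra_simps smult_diff_right[symmetric])
  finally show ?case .
next
  case (filt_add f g)
  then have "(scale u f - f) + (scale u g - g) \<in> filt \<phi> A (r + 1)"
    by (intro filt.filt_add)
  then show ?case by (simp add: pcompose_add algebra_simps)
qed

lemma rs_step_in_filt:
  assumes "\<phi> dvd monom 1 N - 1" "A = 1 + monom 1 N" "f \<in> filt \<phi> A r"
  shows "rs_step f \<in> filt \<phi> A r"
  unfolding rs_step_def using assms
  by (intro filt_add filt_mult_left scale_in_filt[of _ _ N]) (auto simp: monom_power)

lemma rs_step_funpow_in_filt:
  assumes N: "N > 0" and \<phi>: "\<phi> dvd monom 1 N - 1" "\<And>m. 0 < m \<Longrightarrow> m < N \<Longrightarrow> \<phi> dvd qbin N m"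
    and A: "A = 1 + monom 1 N" and f: "f \<in> filt \<phi> A r"
  shows "(rs_step ^^ N) f \<in> filt \<phi> A (r + 1)"
proof -
  let ?t = "\<lambda>m. monom (qbin N m) m * scale (monom 1 (N - m)) f"
  have "{..N} = insert 0 (insert N {0<..<N})" using N by auto
  then have "(rs_step ^^ N) f = scale (monom 1 N) f + (monom 1 N * f + (\<Sum>m\<in>{0<..<N}. ?t m))"
    unfolding rs_step_funpow using N by (simp add: monom_eq_1 scale_1)
  \<comment> \<open>Each of the three parts gains weight: by the factor \<open>A\<close>, by the
    difference bound as \<open>\<phi>\<close> divides \<open>q^N - 1\<close>, and by the middle
    coefficients \<open>qbin N m\<close>, which have weight 2.\<close>
  also have "\<dots> = A * f + (scale (monom 1 N) f - f) + (\<Sum>m\<in>{0<..<N}. ?t m)"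
    unfolding A by (simp add: algebra_simps)
  also have "\<dots> \<in> filt \<phi> A (r + 1)"
  proof (intro filt_add filt_sum)
    show "A * f \<in> filt \<phi> A (r + 1)"
      using filt_mult[OF filt_power_self[of A 1] f] by (simp add: add.commute)
    show "scale (monom 1 N) f - f \<in> filt \<phi> A (r + 1)"
      by (rule scale_diff_in_filt[OF \<phi>(1) A f])
  next
    fix m assume m: "m \<in> {0<..<N}"
    have 1: "monom (qbin N m) m \<in> filt \<phi> A 2"
      using m \<phi>(2) by (intro filt_2I) auto
    have "monom (1::complex) N - 1 dvd monom 1 (N - m) ^ N - 1"
      using power_diff_1_eq[of "monom (1::complex) N" "N - m"]
      by (simp add: monom_power mult.commute)
    then have "scale (monom 1 (N - m)) f \<in> filt \<phi> A r"
      by (intro scale_in_filt[OF _ A f]) (meson dvd_trans \<phi>(1))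
    from filt_mult[OF 1 this] show "?t m \<in> filt \<phi> A (r + 1)" by (elim filt_mono) simp
  qed
  finally show ?thesis .
qed

text \<open>Every block of \<open>N\<close> steps gains one weight, and the remaining
  \<open>n - r * N\<close> steps lose none.\<close>

lemma rs_step_funpow_1_in_filt:
  assumes N: "N > 0" and \<phi>: "\<phi> dvd monom 1 N - 1" "\<And>m. 0 < m \<Longrightarrow> m < N \<Longrightarrow> \<phi> dvd qbin N m"
    and A: "A = 1 + monom 1 N" and n: "n \<ge> r * N"
  shows "(rs_step ^^ n) 1 \<in> filt \<phi> A r"
proof -
  have "(rs_step ^^ (r * N)) 1 \<in> filt \<phi> A r"
  proof (induction r)
    case (Suc r)
    from rs_step_funpow_in_filt[OF N \<phi> A this] show ?case by (simp add: funpow_add)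
  qed simp
  then have "(rs_step ^^ j) ((rs_step ^^ (r * N)) 1) \<in> filt \<phi> A r" for j
    by (induction j) (auto intro: rs_step_in_filt[OF \<phi>(1) A])
  from this[of "n - r * N"] show ?thesis
    using n by (simp flip: funpow_add[THEN fun_cong, unfolded comp_apply])
qed

section \<open>Operators on the filtration\<close>

lemma pderiv_in_filt:
  assumes "f \<in> filt \<phi> A (Suc r)"
  shows "pderiv f \<in> filt \<phi> A r"
  using assms
proof (induction rule: filt.induct)
  case (filt_gen e a g)
  \<comment> \<open>At \<open>a = 0\<close> the truncated subtraction is harmless: then
    \<open>Suc r \<le> 2 * e\<close>.\<close>
  have "pderiv (A ^ a * g) \<in> filt \<phi> A (a - 1)"
  proof -
    have 1: "A ^ a * pderiv g \<in> filt \<phi> A (a - 1)"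
      using filt.filt_gen[of a 0 a \<phi> A "pderiv g"] by (auto elim: filt_mono)
    have "pderiv (A ^ a) = smult (of_nat a) (pderiv A) * A ^ (a - 1)"
      by (cases a) (auto simp: pderiv_power_Suc mult.commute simp del: power_Suc)
    then have "g * pderiv (A ^ a) \<in> filt \<phi> A (a - 1)"
      by (simp only:) (intro filt_mult_left filt_power_self)
    with 1 show ?thesis unfolding pderiv_mult by (rule filt_add)
  qed
  then have "pderiv (smult (\<phi> ^ e) (A ^ a * g)) \<in> filt \<phi> A (2 * e + (a - 1))"
    unfolding pderiv_smult by (rule filt_smult_power)
  then show ?case using filt_gen by (elim filt_mono) auto
qed (auto simp: pderiv_add intro: filt_add)

text \<open>The Euler operator multiplies the coefficient of \<open>x^m\<close> by \<open>m\<close>,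
  so \<open>g\<close> is \<open>P\<close> of that operator applied to \<open>f\<close>, built by
  Horner's scheme; each of the \<open>degree P\<close> applications costs one weight.\<close>

lemma poly_euler_in_filt:
  assumes "f \<in> filt \<phi> A (r + degree P)"
  shows "\<exists>g\<in>filt \<phi> A r. \<forall>m. coeff g m = smult (poly P (of_nat m)) (coeff f m)"
  using assms
proof (induction P arbitrary: r)
  case 0
  show ?case by (intro bexI[of _ 0]) auto
next
  case (pCons b P)
  show ?case
  proof (cases "P = 0")
    case True
    have "[:[:b:]:] * f \<in> filt \<phi> A r" using pCons.prems True by (intro filt_mult_left) simp
    then show ?thesis by (intro bexI[of _ "[:[:b:]:] * f"]) (auto simp: True)
  next
    case False
    then have "f \<in> filt \<phi> A (Suc r + degree P)" using pCons.prems by simp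
    from pCons.IH[OF this] obtain g where g: "g \<in> filt \<phi> A (Suc r)"
      "\<And>m. coeff g m = smult (poly P (of_nat m)) (coeff f m)" by blast
    have "[:[:b:]:] * f + monom 1 1 * pderiv g \<in> filt \<phi> A r"
      using pCons.prems g(1) by (intro filt_add filt_mult_left pderiv_in_filt) (auto elim: filt_mono)
    moreover have "coeff ([:[:b:]:] * f + monom 1 1 * pderiv g) m
        = smult (poly (pCons b P) (of_nat m)) (coeff f m)" for m
      by (cases m)
        (auto simp: coeff_monom_mult coeff_pderiv g(2) smult_add_left of_nat_poly mult.commute[of "of_nat _"]
          simp del: of_nat_Suc)
    ultimately show ?thesis by blast
  qed
qed

section \<open>Coefficientwise differentiation in \<open>q\<close>\<close>

lemma pderiv_sum: "pderiv (sum f I) = (\<Sum>i\<in>I. pderiv (f i))"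
  by (induction I rule: infinite_finite_induct) (auto simp: pderiv_add)

lemma map_poly_pderiv_mult:
  fixes f g :: "complex poly poly"
  shows "map_poly pderiv (f * g) = f * map_poly pderiv g + map_poly pderiv f * g"
  by (intro poly_eqI)
    (simp add: coeff_map_poly coeff_mult pderiv_sum pderiv_mult sum.distrib mult.commute[of "coeff g _"])

lemma map_poly_pderiv_add:
  fixes f g :: "complex poly poly"
  shows "map_poly pderiv (f + g) = map_poly pderiv f + map_poly pderiv g"
  by (intro poly_eqI) (simp add: coeff_map_poly pderiv_add)

lemma map_poly_pderiv_smult:
  fixes f :: "complex poly poly"
  shows "map_poly pderiv (smult p f) = smult (pderiv p) f + smult p (map_poly pderiv f)"
  by (intro poly_eqI) (simp add: coeff_map_poly pderiv_mult mult.commute)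

text \<open>As \<open>A\<close> is free of \<open>q\<close>, the product rule removes at most one
  factor \<open>\<phi>\<close>, of weight 2.\<close>

lemma map_poly_pderiv_in_filt:
  assumes A: "map_poly pderiv A = 0" and "f \<in> filt \<phi> A (r + 2)"
  shows "map_poly pderiv f \<in> filt \<phi> A r"
  using assms(2)
proof (induction rule: filt.induct)
  case (filt_gen e a g)
  have "map_poly pderiv (A ^ a) = 0"
  proof (induction a)
    case 0
    show ?case by (intro poly_eqI) (simp add: coeff_map_poly)
  qed (simp add: map_poly_pderiv_mult A)
  then have "map_poly pderiv (smult (\<phi> ^ e) (A ^ a * g))
      = smult (pderiv (\<phi> ^ e)) (A ^ a * g) + smult (\<phi> ^ e) (A ^ a * map_poly pderiv g)"
    by (simp add: map_poly_pderiv_smult map_poly_pderiv_mult)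
  also have "\<dots> \<in> filt \<phi> A r"
  proof (rule filt_add)
    show "smult (\<phi> ^ e) (A ^ a * map_poly pderiv g) \<in> filt \<phi> A r"
      using filt_gen by (intro filt.filt_gen) simp
    have "smult (pderiv (\<phi> ^ e)) (A ^ a * g)
        = smult (\<phi> ^ (e - 1)) (A ^ a * (smult (of_nat e * pderiv \<phi>) g))"
      by (cases e) (auto simp: pderiv_power_Suc of_nat_mult_conv_smult mult_ac
          simp del: power_Suc of_nat_Suc)
    also have "\<dots> \<in> filt \<phi> A r"
      using filt_gen by (intro filt.filt_gen) auto
    finally show "smult (pderiv (\<phi> ^ e)) (A ^ a * g) \<in> filt \<phi> A r" .
  qed
  finally show ?case .
qed (auto simp: map_poly_pderiv_add intro: filt_add)

lemma map_poly_pderiv_funpow_in_filt: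
  assumes A: "map_poly pderiv A = 0" and "f \<in> filt \<phi> A (r + 2 * l)"
  shows "(map_poly pderiv ^^ l) f \<in> filt \<phi> A r"
  using assms(2)
  by (induction l arbitrary: r) (auto intro!: map_poly_pderiv_in_filt[OF A])

lemma coeff_map_poly_pderiv_funpow:
  "coeff ((map_poly pderiv ^^ l) f) m = (pderiv ^^ l) (coeff f m)"
  by (induction l) (auto simp: coeff_map_poly)

text \<open>Under evaluation a generator becomes divisible by \<open>\<phi> ^ (e + a)\<close>, and
  \<open>2 * (e + a) \<ge> 2 * e + a \<ge> 2 * d + 1\<close> forces
  \<open>e + a \<ge> d + 1\<close>.\<close>

lemma power_dvd_poly_filt:
  assumes "\<phi> dvd poly A u" and "f \<in> filt \<phi> A (2 * d + 1)"
  shows "\<phi> ^ (d + 1) dvd poly f u"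
  using assms(2)
proof (induction rule: filt.induct)
  case (filt_gen e a g)
  have "\<phi> ^ (d + 1) dvd \<phi> ^ (e + a)"
    using filt_gen by (intro le_imp_power_dvd) auto
  also have "\<dots> dvd \<phi> ^ e * (poly A u ^ a * poly g u)"
    unfolding power_add by (intro mult_dvd_mono dvd_mult2 dvd_power_same assms) auto
  finally show ?case by (simp add: poly_power)
qed simp

lemma map_poly_of_int_pderiv_funpow:
  "map_poly of_int ((pderiv ^^ l) p) = (pderiv ^^ l) (map_poly of_int p :: complex poly)"
proof (induction l)
  case (Suc l)
  have "map_poly of_int (pderiv p) = pderiv (map_poly of_int p :: complex poly)" for p
    by (intro poly_eqI) (simp add: coeff_map_poly coeff_pderiv)
  with Suc show ?case by simp
qed simp

theorem theorem1p1:
  fixes c k d l z n :: nat and \<zeta> :: complex and P :: "complex poly"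
  assumes "c > 0" and "k > 0" and "odd k"
    and "primitive_root_of_unity (2 * c) \<zeta>"
    and "P \<in> polys_over (int_adjoin \<zeta>)"
    and "n \<ge> (degree P + 2 * (l + d) + 1) * (k * c)"
  shows "dvd_over (int_adjoin \<zeta>) (cyclotomic_poly (k * c) ^ (d + 1))
    (\<Sum>m=0..n. smult (\<zeta> ^ m * poly P (of_nat m))
      ((monom 1 z) ^ m * map_poly of_int ((pderiv ^^ l) (qbinom n m))))"
    (is "dvd_over ?R _ ?S")
proof -
  define N where "N = k * c"
  define \<phi> where "\<phi> = cyclotomic_poly N"
  define A :: "complex poly poly" where "A = 1 + monom 1 N"
  define u where "u = monom \<zeta> z"
  have N: "N > 0" using assms by (simp add: N_def)
  have \<phi>_dvd: "\<phi> dvd monom 1 (j * N) - 1" for j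
    unfolding \<phi>_def
    by (rule cyclotomic_poly_dvd)
      (auto simp: poly_monom primitive_root_of_unity_def power_mult mult.commute[of j])
  have "\<zeta> ^ (2 * c) = 1" "\<zeta> ^ c \<noteq> 1"
    using assms by (auto simp: primitive_root_of_unity_def)
  then have "\<zeta> ^ c = - 1"
    by (metis mult.commute power_mult power2_eq_1_iff)
  \<comment> \<open>Oddness of \<open>k\<close> keeps the sign, so \<open>A\<close> at
    \<open>x = u\<close> becomes \<open>1 - q^(z N)\<close>.\<close>
  then have "\<zeta> ^ N = - 1"
    using \<open>odd k\<close> by (simp add: N_def mult.commute[of k] power_mult)
  then have "poly A u = - (monom 1 (z * N) - 1)"
    by (simp add: A_def u_def poly_monom monom_power flip: minus_monom)
  then have A_u: "\<phi> dvd poly A u"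
    using \<phi>_dvd by (simp only: dvd_minus_iff)
  have dA: "map_poly pderiv A = 0"
    by (intro poly_eqI) (simp add: A_def coeff_map_poly pderiv_add)

  \<comment> \<open>The weight budget is exactly the assumed bound on \<open>n\<close> divided by
    \<open>N\<close>: \<open>2 * l\<close> for the \<open>q\<close>-derivatives,
    \<open>degree P\<close> for the Euler operators, \<open>2 * d + 1\<close> for the final
    divisibility.\<close>
  have "(rs_step ^^ n) 1 \<in> filt \<phi> A (2 * d + 1 + degree P + 2 * l)"
    using assms(6) \<phi>_dvd[of 1] cyclotomic_poly_dvd_qbin[of _ N, folded \<phi>_def]
    by (intro rs_step_funpow_1_in_filt[OF N _ _ A_def]) (auto simp: N_def algebra_simps)
  then have "(map_poly pderiv ^^ l) ((rs_step ^^ n) 1) \<in> filt \<phi> A (2 * d + 1 + degree P)"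
    by (rule map_poly_pderiv_funpow_in_filt[OF dA])
  from poly_euler_in_filt[OF this] obtain g where g: "g \<in> filt \<phi> A (2 * d + 1)"
    and cg: "\<And>m. coeff g m = smult (poly P (of_nat m)) ((pderiv ^^ l) (qbin n m))"
    by (auto simp: coeff_map_poly_pderiv_funpow coeff_rs_step_funpow_1)
  have deg: "degree g \<le> n"
    by (rule degree_le) (auto simp: cg qbin_eq_0 simp flip: map_poly_of_int_pderiv_funpow)
  have "poly g u = (\<Sum>m\<le>n. coeff g m * u ^ m)"
    unfolding poly_altdef using deg
    by (intro sum.mono_neutral_left) (auto simp: coeff_eq_0)
  also have "\<dots> = ?S"
    unfolding atLeast0AtMost
  proof (intro sum.cong refl)
    fix m
    have "u ^ m = smult (\<zeta> ^ m) (monom 1 z ^ m)"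
      by (simp add: u_def monom_power smult_monom)
    then show "coeff g m * u ^ m = smult (\<zeta> ^ m * poly P (of_nat m))
        (monom 1 z ^ m * map_poly of_int ((pderiv ^^ l) (qbinom n m)))"
      by (simp add: cg qbin_def map_poly_of_int_pderiv_funpow mult.commute)
  qed
  finally have "\<phi> ^ (d + 1) dvd ?S"
    using power_dvd_poly_filt[OF A_u g] by simp
  then obtain h where h: "?S = \<phi> ^ (d + 1) * h" by (elim dvdE)

  \<comment> \<open>So far \<open>h\<close> is only a complex polynomial; since
    \<open>\<phi> ^ (d + 1)\<close> is monic over \<open>?R\<close>, its coefficients descend to
    \<open>?R\<close>.\<close>
  have R: "is_subring ?R" by (rule is_subring_int_adjoin)
  have "?S \<in> polys_over ?R"
    by (intro polys_over_sum polys_over_smult polys_over_mult polys_over_power polys_over_monom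
        polys_over_map_poly_of_int is_subringD is_subring_power poly_in_subring
        self_in_int_adjoin R assms)
  moreover have "\<phi> ^ (d + 1) \<in> polys_over ?R"
    unfolding \<phi>_def by (intro polys_over_power cyclotomic_poly_over R)
  moreover have "lead_coeff (\<phi> ^ (d + 1)) = 1"
    unfolding \<phi>_def lead_coeff_power monic_cyclotomic_poly by simp
  ultimately have "h \<in> polys_over ?R"
    unfolding h by (rule polys_over_monic_quotient[OF R, rotated 2])
  then show ?thesis
    unfolding dvd_over_def using h by (auto simp: \<phi>_def N_def)
qed

end
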